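(* Let $G$ be a topological group which admits an open subgroup of infinite index. Then every net $(\mu_i)_{i\in I}$ of tight Borel probability measures on $G$ that UEB-converges to invariance over $G$ dissipates in $G$ (where $G$ is endowed with its right uniformity).
   Context: All topological groups are assumed Hausdorff. For a topological group $G$, let $\mathcal{U}(G)$ be the neighborhood filter of the neutral element. $G$ is equipped with its right uniformity, with basic entourages $U_{r} = \{(x,y)\in G\times G \mid yx^{-1}\in U\}$ for $U\in\mathcal{U}(G)$. A set $H$ of real-valued functions on $G$ belongs to $\mathrm{RUEB}(G)$ if it consists of bounded functions that are uniformly continuous for the right uniformity, it is bounded in the supremum norm, and it is uniformly equicontinuous: for every $\epsilon>0$ there is an entourage $V$ of the right uniformity with $|f(x)-f(y)|\le\epsilon$ for all $f\in H$ and $(x,y)\in V$. For $g\in G$, let $\lambda_g\colon G\to G$, $x\mapsto gx$. A net $(\mu_i)_{i\in I}$ of Borel probability measures on $G$ UEB-converges to invariance (over $G$) if for all $g\in G$ and all $H\in\mathrm{RUEB}(G)$, $$\sup_{f\in H}\left|\int f\circ\lambda_g\,d\mu_i-\int f\,d\mu_i\right|\longrightarrow 0\quad(i\to I).$$ A Borel probability measure $\nu$ on a Hausdorff space $T$ is tight if for every $\epsilon>0$ there is a compact $K\subseteq T$ with $\nu(K)\ge 1-\epsilon$. Let $X$ be a uniform space and $U$ an entourage of $X$. A net $(\mu_i)_{i\in I}$ of Borel probability measures on $X$ $U$-dissipates in $X$ if there is a family $(\mathcal{B}_i)_{i\in I}$ of finite sets of Borel subsets of $X$ such that (1) $(B\times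 C)\cap U=\emptyset$ for every $i\in I$ and any two distinct $B,C\in\mathcal{B}_i$; (2) $\lim_{i\to I}\mu_i(\bigcup\mathcal{B}_i)=1$; (3) $\lim_{i\to I}\sup\{\mu_i(B)\mid B\in\mathcal{B}_i\}=0$. The net dissipates in $X$ if it $U$-dissipates for some entourage $U$ of $X$. *)

theory Defs
  imports "HOL-Probability.Probability"
begin

text \<open>
  Groups are written additively, as in the library class \<open>topological_group_add\<close>, whose addition
  is not assumed commutative: \<open>g + x\<close> stands for the product \<open>g x\<close>, \<open>- x\<close> for the inverse,
  \<open>y - x = y + (- x)\<close> for \<open>y x\<^sup>-\<^sup>1\<close> and \<open>0\<close> for the neutral element.
\<close>

section \<open>Nets\<close>

definition directed_on :: "'i set \<Rightarrow> ('i \<times> 'i) set \<Rightarrow> bool" where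
  "directed_on I r \<longleftrightarrow>
     I \<noteq> {} \<and> preorder_on I r \<and> (\<forall>i\<in>I. \<forall>j\<in>I. \<exists>k\<in>I. (i, k) \<in> r \<and> (j, k) \<in> r)"

definition tails :: "'i set \<Rightarrow> ('i \<times> 'i) set \<Rightarrow> 'i filter" where
  "tails I r = (INF i\<in>I. principal {j \<in> I. (i, j) \<in> r})"

lemma eventually_tails:
  assumes "directed_on I r"
  shows "eventually P (tails I r) \<longleftrightarrow> (\<exists>i\<in>I. \<forall>j\<in>I. (i, j) \<in> r \<longrightarrow> P j)"
proof -
  have tr: "trans r" and ne: "I \<noteq> {}"
    and dir: "\<And>i j. i \<in> I \<Longrightarrow> j \<in> I \<Longrightarrow> \<exists>k\<in>I. (i, k) \<in> r \<and> (j, k) \<in> r"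
    using assms by (auto simp: directed_on_def preorder_on_def)
  have "eventually P (tails I r) \<longleftrightarrow> (\<exists>i\<in>I. eventually P (principal {j \<in> I. (i, j) \<in> r}))"
    unfolding tails_def
  proof (rule eventually_INF_base[OF ne])
    fix a b assume "a \<in> I" "b \<in> I"
    then obtain k where "k \<in> I" "(a, k) \<in> r" "(b, k) \<in> r"
      using dir by blast
    then show "\<exists>x\<in>I. principal {j \<in> I. (x, j) \<in> r}
        \<le> inf (principal {j \<in> I. (a, j) \<in> r}) (principal {j \<in> I. (b, j) \<in> r})"
      using tr by (intro bexI[of _ k]) (auto dest: transD)
  qed
  then show ?thesis
    by (auto simp: eventually_principal)
qed

section \<open>The right uniformity\<close>

definition right_uniformity :: "('a::topological_group_add \<times> 'a) filter" where
  "right_uniformity = filtercomap (\<lambda>(x, y). y - x) (nhds 0)"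

definition entourage :: "('a \<times> 'a) filter \<Rightarrow> ('a \<times> 'a) set \<Rightarrow> bool" where
  "entourage \<U> V \<longleftrightarrow> eventually (\<lambda>p. p \<in> V) \<U>"

lemma entourage_right_uniformity_iff:
  "entourage right_uniformity (V :: ('a::topological_group_add \<times> 'a) set) \<longleftrightarrow>
     (\<exists>U. eventually (\<lambda>x. x \<in> U) (nhds 0) \<and> {(x, y). y - x \<in> U} \<subseteq> V)"
proof
  assume "entourage right_uniformity V"
  then obtain P where "eventually P (nhds (0::'a))" "\<And>x y. P (y - x) \<Longrightarrow> (x, y) \<in> V"
    unfolding entourage_def right_uniformity_def eventually_filtercomap by auto
  then show "\<exists>U. eventually (\<lambda>x. x \<in> U) (nhds 0) \<and> {(x, y). y - x \<in> U} \<subseteq> V"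
    by (intro exI[of _ "Collect P"]) auto
qed (auto simp: entourage_def right_uniformity_def eventually_filtercomap)

text \<open>
  The right uniformity is a uniformity, and it induces the given topology. Hence Borel sets with
  respect to the uniform topology are Borel sets of the group.
\<close>

lemma uniform_space_right_uniformity:
  "class.uniform_space open (right_uniformity :: ('a::topological_group_add \<times> 'a) filter)"
proof
  have ev: "eventually P right_uniformity \<longleftrightarrow>
      (\<exists>Q. eventually Q (nhds 0) \<and> (\<forall>x y. Q (y - x) \<longrightarrow> P (x, y)))" for P :: "'a \<times> 'a \<Rightarrow> bool"
    by (auto simp: right_uniformity_def eventually_filtercomap)
  show "open U \<longleftrightarrow> (\<forall>x\<in>U. eventually (\<lambda>(x', y). x' = x \<longrightarrow> y \<in> U) right_uniformity)"
    for U :: "'a set"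
  proof
    assume U: "open U"
    show "\<forall>x\<in>U. eventually (\<lambda>(x', y). x' = x \<longrightarrow> y \<in> U) right_uniformity"
    proof
      fix x assume x: "x \<in> U"
      have "((\<lambda>z. z + x) \<longlongrightarrow> 0 + x) (nhds 0)"
        by (intro tendsto_intros filterlim_ident)
      then have "eventually (\<lambda>z. z + x \<in> U) (nhds 0)"
        using U x by (auto dest: topological_tendstoD)
      then show "eventually (\<lambda>(x', y). x' = x \<longrightarrow> y \<in> U) right_uniformity"
        unfolding ev by (intro exI[of _ "\<lambda>z. z + x \<in> U"]) auto
    qed
  next
    assume *: "\<forall>x\<in>U. eventually (\<lambda>(x', y). x' = x \<longrightarrow> y \<in> U) right_uniformity"
    have "eventually (\<lambda>y. y \<in> U) (nhds x)" if "x \<in> U" for x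
    proof -
      from * that obtain Q where Q: "eventually Q (nhds 0)" "\<And>y. Q (y - x) \<Longrightarrow> y \<in> U"
        unfolding ev by auto
      have "((\<lambda>y. y + - x) \<longlongrightarrow> x + - x) (nhds x)"
        by (intro tendsto_intros filterlim_ident)
      then have "filterlim (\<lambda>y. y - x) (nhds 0) (nhds x)"
        by simp
      then have "eventually (\<lambda>y. Q (y - x)) (nhds x)"
        using Q(1) by (simp add: filterlim_iff)
      then show ?thesis
        by eventually_elim (rule Q(2))
    qed
    then show "open U"
      by (subst open_subopen) (metis eventually_nhds subsetI)
  qed
  show "E (x, x)" if "eventually E right_uniformity" for E and x :: 'a
    using that unfolding ev by (metis diff_self eventually_nhds_x_imp_x)
  show "eventually (\<lambda>(x, y). E (y, x)) right_uniformity" if "eventually E right_uniformity"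
    for E :: "'a \<times> 'a \<Rightarrow> bool"
  proof -
    from that obtain Q where Q: "eventually Q (nhds 0)" "\<And>x y. Q (y - x) \<Longrightarrow> E (x, y)"
      unfolding ev by auto
    have "((\<lambda>z. - z) \<longlongrightarrow> - 0) (nhds (0::'a))"
      by (intro tendsto_intros filterlim_ident)
    then have "eventually (\<lambda>z. Q (- z)) (nhds 0)"
      using Q(1) by (simp add: filterlim_iff)
    then show ?thesis
      unfolding ev by (intro exI[of _ "\<lambda>z. Q (- z)"]) (auto intro: Q(2))
  qed
  show "\<exists>D. eventually D right_uniformity \<and> (\<forall>x y z. D (x, y) \<longrightarrow> D (y, z) \<longrightarrow> E (x, z))"
    if "eventually E right_uniformity" for E :: "'a \<times> 'a \<Rightarrow> bool"
  proof -
    from that obtain Q where Q: "eventually Q (nhds 0)" "\<And>x y. Q (y - x) \<Longrightarrow> E (x, y)"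
      unfolding ev by auto
    have "filterlim (\<lambda>z. fst z + snd z) (nhds (0 + 0)) (nhds (0::'a) \<times>\<^sub>F nhds 0)"
      by (intro tendsto_intros filterlim_fst filterlim_snd)
    then have "eventually (\<lambda>z. Q (fst z + snd z)) (nhds 0 \<times>\<^sub>F nhds 0)"
      using Q(1) by (simp add: filterlim_iff)
    then obtain P1 P2 where P: "eventually P1 (nhds 0)" "eventually P2 (nhds 0)"
      "\<And>u v. P1 u \<Longrightarrow> P2 v \<Longrightarrow> Q (u + v)"
      unfolding eventually_prod_filter by auto
    define R where "R z \<longleftrightarrow> P1 z \<and> P2 z" for z
    have "eventually R (nhds 0)"
      unfolding R_def using P(1,2) by (rule eventually_conj)
    moreover have "E (x, z)" if "R (y - x)" "R (z - y)" for x y z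
    proof -
      have "Q ((z - y) + (y - x))"
        using that by (intro P(3)) (auto simp: R_def)
      also have "(z - y) + (y - x) = z - x"
        by (metis add_diff_eq diff_add_cancel)
      finally show ?thesis
        by (rule Q(2))
    qed
    ultimately show ?thesis
      by (intro exI[of _ "\<lambda>(x, y). R (y - x)"]) (auto simp: ev)
  qed
qed

section \<open>Convergence to invariance and dissipation\<close>

definition RUEB :: "('a::topological_group_add \<Rightarrow> real) set set" where
  "RUEB = {H.
     (\<forall>f\<in>H. bounded (range f) \<and>
        filterlim (\<lambda>(x, y). (f x, f y)) uniformity right_uniformity) \<and>
     (\<exists>C. \<forall>f\<in>H. \<forall>x. \<bar>f x\<bar> \<le> C) \<and>
     (\<forall>\<epsilon>>0. \<exists>V. entourage right_uniformity V \<and>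
        (\<forall>f\<in>H. \<forall>(x, y)\<in>V. \<bar>f x - f y\<bar> \<le> \<epsilon>))}"

definition borel_prob :: "'a::topological_space measure \<Rightarrow> bool" where
  "borel_prob M \<longleftrightarrow> prob_space M \<and> sets M = sets borel"

definition tight_measure :: "'a::t2_space measure \<Rightarrow> bool" where
  "tight_measure M \<longleftrightarrow> (\<forall>\<epsilon>>0. \<exists>K. compact K \<and> measure M K \<ge> 1 - \<epsilon>)"

text \<open>
  Suprema are taken in \<^typ>\<open>ennreal\<close>, so that the supremum over an empty family is \<open>0\<close>.
\<close>

definition UEB_converges_to_invariance ::
    "'i set \<Rightarrow> ('i \<times> 'i) set \<Rightarrow> ('i \<Rightarrow> 'a::topological_group_add measure) \<Rightarrow> bool" where
  "UEB_converges_to_invariance I r \<mu> \<longleftrightarrow>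
     (\<forall>g. \<forall>H\<in>RUEB.
        ((\<lambda>i. SUP f\<in>H. ennreal \<bar>(\<integral>x. f (g + x) \<partial>\<mu> i) - (\<integral>x. f x \<partial>\<mu> i)\<bar>) \<longlongrightarrow> 0) (tails I r))"

definition dissipates_wrt ::
    "('a::topological_space \<times> 'a) set \<Rightarrow> 'i set \<Rightarrow> ('i \<times> 'i) set \<Rightarrow> ('i \<Rightarrow> 'a measure) \<Rightarrow> bool" where
  "dissipates_wrt U I r \<mu> \<longleftrightarrow>
     (\<exists>\<B>. (\<forall>i\<in>I. finite (\<B> i) \<and> \<B> i \<subseteq> sets borel) \<and>
          (\<forall>i\<in>I. \<forall>B\<in>\<B> i. \<forall>C\<in>\<B> i. B \<noteq> C \<longrightarrow> (B \<times> C) \<inter> U = {}) \<and>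
          ((\<lambda>i. emeasure (\<mu> i) (\<Union>(\<B> i))) \<longlongrightarrow> 1) (tails I r) \<and>
          ((\<lambda>i. SUP B\<in>\<B> i. emeasure (\<mu> i) B) \<longlongrightarrow> 0) (tails I r))"

text \<open>The uniformity \<open>\<U>\<close> is meant to be one that induces the topology of the type \<open>'a\<close>.\<close>

definition dissipates ::
    "('a::topological_space \<times> 'a) filter \<Rightarrow> 'i set \<Rightarrow> ('i \<times> 'i) set \<Rightarrow> ('i \<Rightarrow> 'a measure) \<Rightarrow> bool"
  where
  "dissipates \<U> I r \<mu> \<longleftrightarrow> (\<exists>U. entourage \<U> U \<and> dissipates_wrt U I r \<mu>)"

section \<open>Subgroups of infinite index\<close>

definition add_subgroup :: "'a::group_add set \<Rightarrow> bool" where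
  "add_subgroup H \<longleftrightarrow> 0 \<in> H \<and> (\<forall>x\<in>H. \<forall>y\<in>H. x + y \<in> H) \<and> (\<forall>x\<in>H. - x \<in> H)"

definition infinite_index :: "'a::group_add set \<Rightarrow> bool" where
  "infinite_index H \<longleftrightarrow> infinite (range (\<lambda>g. (\<lambda>h. g + h) ` H))"

end

theory Submission
  imports Defs
begin

text \<open>
  Let \<open>H\<close> be an open subgroup of infinite index. Points in different right cosets \<open>H + x\<close> are not
  close with respect to the entourage \<open>{(x, y). y - x \<in> H}\<close>, so right cosets are the natural
  pieces into which the measures can be split; the point is that they become small uniformly.

  Since \<open>H\<close> is open, the indicator functions of all right cosets together form a \<^const>\<open>RUEB\<close> set.
  Hence, along the net, \<open>\<mu>\<^sub>i (a + H + x)\<close> gets close to \<open>\<mu>\<^sub>i (H + x)\<close> uniformly in \<open>x\<close>, for each of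
  finitely many chosen \<open>a\<close>. If the \<open>a\<close> represent \<open>n\<close> distinct left cosets of \<open>H\<close>, then for every
  \<open>x\<close> the \<open>n\<close> sets \<open>a + H + x\<close> are disjoint, so that \<open>\<mu>\<^sub>i (H + x)\<close> is at most roughly \<open>1 / n\<close>
  (\<open>eventually_uniformly_small_right_cosets\<close>).

  It remains to choose finitely many cosets carrying almost all of \<open>\<mu>\<^sub>i\<close>. A compact set meets only
  finitely many right cosets, so tightness allows any prescribed error \<open>\<epsilon>\<^sub>i > 0\<close>; but the errors
  have to tend to \<open>0\<close> along a net that need not have a countable cofinal subset. The measures
  supply such errors themselves: by tightness some right coset has positive
  measure (\<open>tight_measure_pos_right_coset\<close>), and this measure serves as \<open>\<epsilon>\<^sub>i\<close>.
\<close>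

section \<open>Right cosets of an open subgroup\<close>

definition right_coset :: "'a::group_add set \<Rightarrow> 'a \<Rightarrow> 'a set" where
  "right_coset H x = {y. y - x \<in> H}"

lemma diff_add_diff_cancel: "(x - y) + (y - z) = x - (z :: 'a::group_add)"
  by (metis add_diff_eq diff_add_cancel)

lemma right_coset_self: "add_subgroup H \<Longrightarrow> x \<in> right_coset H x"
  by (simp add: right_coset_def add_subgroup_def)

lemma diff_mem_subgroup_commute:
  assumes "add_subgroup H" "x - y \<in> H"
  shows "y - x \<in> H"
proof -
  have "- (x - y) \<in> H"
    using assms by (auto simp: add_subgroup_def)
  then show ?thesis
    by simp
qed

lemma diff_mem_subgroup_trans:
  assumes "add_subgroup H" "x - y \<in> H" "y - z \<in> H"
  shows "x - z \<in> H"
  using assms diff_add_diff_cancel[of x y z] by (metis add_subgroup_def)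

lemma right_coset_eqI:
  assumes "add_subgroup H" "y - x \<in> H"
  shows "right_coset H x = right_coset H y"
  using assms diff_mem_subgroup_commute diff_mem_subgroup_trans
  unfolding right_coset_def by blast

lemma right_cosets_separated:
  assumes H: "add_subgroup H" and "right_coset H x \<noteq> right_coset H y"
  shows "(right_coset H x \<times> right_coset H y) \<inter> {(u, v). v - u \<in> H} = {}"
proof (rule ccontr)
  assume "(right_coset H x \<times> right_coset H y) \<inter> {(u, v). v - u \<in> H} \<noteq> {}"
  then obtain u v where "u - x \<in> H" "v - y \<in> H" "v - u \<in> H"
    by (auto simp: right_coset_def)
  then have "right_coset H x = right_coset H u" "right_coset H u = right_coset H v"
      "right_coset H y = right_coset H v"
    using H by (auto intro!: right_coset_eqI)
  with assms(2) show False
    by simp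
qed

lemma open_right_coset:
  fixes H :: "'a::topological_group_add set"
  assumes "open H"
  shows "open (right_coset H x)"
proof -
  have "open ((\<lambda>y. y - x) -` H)"
    by (intro open_vimage assms continuous_intros)
  then show ?thesis
    by (simp add: right_coset_def vimage_def)
qed

lemma entourage_open_subgroup:
  fixes H :: "'a::topological_group_add set"
  assumes "add_subgroup H" "open H"
  shows "entourage right_uniformity {(x, y). y - x \<in> H}"
proof -
  have "eventually (\<lambda>x. x \<in> H) (nhds 0)"
    using assms by (intro eventually_nhds_in_open) (auto simp: add_subgroup_def)
  then show ?thesis
    unfolding entourage_right_uniformity_iff by (intro exI[of _ H]) auto
qed

lemma finite_right_cosets_compact:
  fixes H :: "'a::topological_group_add set"
  assumes H: "add_subgroup H" "open H" and K: "compact K"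
  shows "finite (right_coset H ` K)"
proof -
  have "K \<subseteq> (\<Union>x\<in>K. right_coset H x)"
    using right_coset_self[OF H(1)] by blast
  then obtain F where F: "F \<subseteq> K" "finite F" "K \<subseteq> (\<Union>x\<in>F. right_coset H x)"
    using compactE_image[OF K, of K "right_coset H"] open_right_coset[OF H(2)] by metis
  have "right_coset H ` K \<subseteq> right_coset H ` F"
  proof
    fix C assume "C \<in> right_coset H ` K"
    then obtain y where y: "y \<in> K" "C = right_coset H y"
      by auto
    then obtain x where x: "x \<in> F" "y - x \<in> H"
      using F(3) by (auto simp: right_coset_def)
    then show "C \<in> right_coset H ` F"
      using y right_coset_eqI[OF H(1), of y x] by auto
  qed
  then show ?thesis
    using F(2) finite_surj by auto
qed

text \<open>
  Each of these functions is constant on right cosets, so the single entourage given by \<open>H\<close>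
  witnesses equicontinuity for every \<open>\<epsilon>\<close>.
\<close>

lemma RUEB_indicators_right_cosets:
  fixes H :: "'a::topological_group_add set"
  assumes H: "add_subgroup H" "open H"
  shows "range (\<lambda>x. indicator (right_coset H x)) \<in> (RUEB :: ('a \<Rightarrow> real) set set)"
proof -
  have const: "(indicator (right_coset H z) x :: real) = indicator (right_coset H z) y"
    if "y - x \<in> H" for x y z
  proof -
    have "x - z \<in> H \<longleftrightarrow> y - z \<in> H"
      using that H(1) diff_mem_subgroup_commute diff_mem_subgroup_trans by blast
    then show ?thesis
      by (simp add: right_coset_def indicator_def)
  qed
  have unif: "filterlim (\<lambda>(x, y). (indicator (right_coset H z) x :: real,
      indicator (right_coset H z) y)) uniformity right_uniformity" for z
    unfolding filterlim_iff
  proof (intro allI impI)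
    fix P :: "real \<times> real \<Rightarrow> bool" assume P: "eventually P uniformity"
    have "eventually (\<lambda>p. p \<in> {(x, y). y - x \<in> H}) right_uniformity"
      using entourage_open_subgroup[OF H] by (simp add: entourage_def)
    then show "eventually (\<lambda>p. P (case p of (x, y) \<Rightarrow>
        (indicator (right_coset H z) x, indicator (right_coset H z) y))) right_uniformity"
      by eventually_elim (use const uniformity_refl[OF P] in auto)
  qed
  have bdd: "bounded (range (indicator (right_coset H z) :: 'a \<Rightarrow> real))" for z
    by (rule boundedI[of _ 1]) (auto simp: indicator_def)
  show ?thesis
    unfolding RUEB_def
  proof (intro CollectI conjI)
    show "\<exists>C. \<forall>f\<in>range (\<lambda>x. indicator (right_coset H x)). \<forall>x. \<bar>f x :: real\<bar> \<le> C"
      by (intro exI[of _ 1]) (auto simp: indicator_def)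
    show "\<forall>\<epsilon>>0. \<exists>V. entourage right_uniformity V \<and>
        (\<forall>f\<in>range (\<lambda>x. indicator (right_coset H x)). \<forall>(x, y)\<in>V. \<bar>f x - f y :: real\<bar> \<le> \<epsilon>)"
      using entourage_open_subgroup[OF H] const
      by (intro allI impI exI[of _ "{(x, y). y - x \<in> H}"]) auto
  qed (use unif bdd in auto)
qed

lemma infinite_index_representatives:
  assumes "infinite_index H"
  obtains A where "finite A" "card A = n" "inj_on (\<lambda>g. (\<lambda>h. g + h) ` H) A"
proof -
  obtain T where T: "T \<subseteq> range (\<lambda>g. (\<lambda>h. g + h) ` H)" "finite T" "card T = n"
    using assms infinite_arbitrarily_large unfolding infinite_index_def by metis
  then obtain A where "A \<subseteq> UNIV" "inj_on (\<lambda>g. (\<lambda>h. g + h) ` H) A" "T = (\<lambda>g. (\<lambda>h. g + h) ` H) ` A"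
    by (metis subset_image_inj)
  with T show ?thesis
    by (intro that[of A]) (auto simp: card_image finite_image_iff)
qed

text \<open>
  The set \<open>{y. - a + y \<in> right_coset H x}\<close> is \<open>a + H + x\<close>: a left coset of \<open>H\<close> translated by \<open>x\<close>
  on the right. Distinct left cosets are disjoint, and whether they are distinct does not depend
  on \<open>x\<close>; this is what makes the later estimate uniform in \<open>x\<close>.
\<close>

lemma disjoint_left_translates_right_coset:
  assumes H: "add_subgroup H" and A: "inj_on (\<lambda>g. (\<lambda>h. g + h) ` H) A"
  shows "disjoint_family_on (\<lambda>a. {y. - a + y \<in> right_coset H x}) A"
  unfolding disjoint_family_on_def
proof (intro ballI impI, rule ccontr)
  fix a b assume ab: "a \<in> A" "b \<in> A" "a \<noteq> b"
    and "{y. - a + y \<in> right_coset H x} \<inter> {y. - b + y \<in> right_coset H x} \<noteq> {}"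
  then obtain y where y: "- a + y - x \<in> H" "- b + y - x \<in> H"
    by (auto simp: right_coset_def)
  have sub: "(\<lambda>h. c + h) ` H \<subseteq> (\<lambda>h. d + h) ` H"
    if "- c + y - x \<in> H" "- d + y - x \<in> H" for c d
  proof
    fix z assume "z \<in> (\<lambda>h. c + h) ` H"
    then obtain h where h: "h \<in> H" "z = c + h"
      by auto
    have "(- d + y - x) + - (- c + y - x) + h \<in> H"
      using H that h(1) by (simp only: add_subgroup_def)
    also have "(- d + y - x) + - (- c + y - x) + h = - d + z"
      using diff_add_diff_cancel[of y x y]
      by (simp add: h(2) minus_add diff_conv_add_uminus add.assoc del: add_uminus_conv_diff)
    finally show "z \<in> (\<lambda>h. d + h) ` H"
      by (intro image_eqI[of _ _ "- d + z"]) (simp_all add: add.assoc[symmetric])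
  qed
  have "(\<lambda>h. a + h) ` H = (\<lambda>h. b + h) ` H"
    using sub y by blast
  with A ab show False
    by (auto dest: inj_onD)
qed

section \<open>Measures of right cosets along the net\<close>

text \<open>
  With \<open>n > 2 / \<delta>\<close> left coset representatives \<open>a\<close>, invariance up to \<open>\<delta> / 2\<close> gives
  \<open>n (\<mu>\<^sub>i (H + x) - \<delta> / 2) \<le> \<Sum>\<^sub>a \<mu>\<^sub>i (a + H + x) \<le> 1\<close>. The representatives are chosen before
  \<open>x\<close>, and the convergence is uniform over the indicators, so one tail of the net serves all \<open>x\<close>.
\<close>

lemma eventually_uniformly_small_right_cosets:
  fixes \<mu> :: "'i \<Rightarrow> 'a::topological_group_add measure"
  assumes H: "add_subgroup H" "open H" "infinite_index H"
    and dir: "directed_on I r"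
    and prob: "\<And>i. i \<in> I \<Longrightarrow> borel_prob (\<mu> i)"
    and inv: "UEB_converges_to_invariance I r \<mu>"
    and \<delta>: "\<delta> > 0"
  shows "eventually (\<lambda>i. \<forall>x. measure (\<mu> i) (right_coset H x) \<le> \<delta>) (tails I r)"
proof -
  obtain n :: nat where n: "n > 0" "1 / real n < \<delta> / 2"
    using \<delta> nat_approx_posE[of "\<delta> / 2"] by (metis half_gt_zero zero_less_Suc)
  obtain A where A: "finite A" "card A = n" "inj_on (\<lambda>g. (\<lambda>h. g + h) ` H) A"
    using infinite_index_representatives[OF H(3)] by metis
  let ?F = "range (\<lambda>x. indicator (right_coset H x)) :: ('a \<Rightarrow> real) set"
  have "eventually (\<lambda>i. (SUP f\<in>?F. ennreal \<bar>(\<integral>x. f (- a + x) \<partial>\<mu> i) - (\<integral>x. f x \<partial>\<mu> i)\<bar>)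
      < ennreal (\<delta> / 2)) (tails I r)" for a
    using inv RUEB_indicators_right_cosets[OF H(1,2)] \<delta>
    unfolding UEB_converges_to_invariance_def by (intro order_tendstoD(2)) auto
  then have "eventually (\<lambda>i. \<forall>a\<in>A.
      (SUP f\<in>?F. ennreal \<bar>(\<integral>x. f (- a + x) \<partial>\<mu> i) - (\<integral>x. f x \<partial>\<mu> i)\<bar>)
      < ennreal (\<delta> / 2)) (tails I r)"
    using A(1) by (simp add: eventually_ball_finite_distrib)
  moreover have "eventually (\<lambda>i. i \<in> I) (tails I r)"
    using dir by (auto simp: eventually_tails directed_on_def)
  ultimately show ?thesis
  proof eventually_elim
    case (elim i)
    interpret prob_space "\<mu> i"
      using prob elim by (simp add: borel_prob_def)
    have sets: "sets (\<mu> i) = sets borel"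
      using prob elim by (simp add: borel_prob_def)
    then have space: "space (\<mu> i) = UNIV"
      by (metis sets_eq_imp_space_eq space_borel)
    show ?case
    proof
      fix x
      let ?C = "right_coset H x"
      let ?T = "\<lambda>a. {y. - a + y \<in> ?C}"
      have C: "?C \<in> sets (\<mu> i)"
        using open_right_coset[OF H(2)] by (simp add: sets)
      have T: "?T a \<in> sets (\<mu> i)" for a
      proof -
        have "open ((\<lambda>y. - a + y) -` ?C)"
          by (intro open_vimage open_right_coset H continuous_intros)
        then show ?thesis
          by (simp add: sets vimage_def)
      qed
      have close: "measure (\<mu> i) ?C \<le> measure (\<mu> i) (?T a) + \<delta> / 2" if "a \<in> A" for a
      proof -
        let ?f = "indicator ?C :: 'a \<Rightarrow> real"
        have "ennreal \<bar>(\<integral>x. ?f (- a + x) \<partial>\<mu> i) - (\<integral>x. ?f x \<partial>\<mu> i)\<bar>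
            \<le> (SUP f\<in>?F. ennreal \<bar>(\<integral>x. f (- a + x) \<partial>\<mu> i) - (\<integral>x. f x \<partial>\<mu> i)\<bar>)"
          by (rule SUP_upper) auto
        also have "\<dots> < ennreal (\<delta> / 2)"
          using elim that by blast
        finally have "\<bar>(\<integral>x. ?f (- a + x) \<partial>\<mu> i) - (\<integral>x. ?f x \<partial>\<mu> i)\<bar> < \<delta> / 2"
          using \<delta> by (simp add: ennreal_less_iff)
        moreover have "(\<lambda>x. ?f (- a + x)) = indicator (?T a)"
          by (auto simp: indicator_def)
        ultimately show ?thesis
          unfolding abs_less_iff by (simp add: space)
      qed
      have "real n * measure (\<mu> i) ?C = (\<Sum>a\<in>A. measure (\<mu> i) ?C)"
        by (simp add: A(2))
      also have "\<dots> \<le> (\<Sum>a\<in>A. measure (\<mu> i) (?T a) + \<delta> / 2)"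
        using close by (rule sum_mono)
      also have "\<dots> = (\<Sum>a\<in>A. measure (\<mu> i) (?T a)) + real n * (\<delta> / 2)"
        by (simp only: sum.distrib sum_constant A(2))
      also have "(\<Sum>a\<in>A. measure (\<mu> i) (?T a)) = measure (\<mu> i) (\<Union>a\<in>A. ?T a)"
      proof (rule finite_measure_finite_Union[symmetric, OF A(1)])
        show "?T ` A \<subseteq> sets (\<mu> i)"
          using T by blast
        show "disjoint_family_on ?T A"
          by (rule disjoint_left_translates_right_coset[OF H(1) A(3)])
      qed
      also have "measure (\<mu> i) (\<Union>a\<in>A. ?T a) + real n * (\<delta> / 2) \<le> 1 + real n * (\<delta> / 2)"
        by (intro add_right_mono prob_le_1)
      finally have "real n * measure (\<mu> i) ?C \<le> 1 + real n * (\<delta> / 2)" .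
      then have "measure (\<mu> i) ?C \<le> 1 / real n + \<delta> / 2"
        using n(1) by (simp add: field_simps)
      then show "measure (\<mu> i) ?C \<le> \<delta>"
        using n(2) by linarith
    qed
  qed
qed

lemma measure_compact_le_right_cosets:
  fixes M :: "'a::{topological_group_add, t2_space} measure"
  assumes H: "add_subgroup H" "open H" and M: "borel_prob M" and K: "compact K"
  shows "measure M K \<le> measure M (\<Union>(right_coset H ` K))"
proof -
  interpret prob_space M
    using M by (simp add: borel_prob_def)
  have "open (\<Union>(right_coset H ` K))"
    using open_right_coset[OF H(2)] by auto
  then show ?thesis
    using M right_coset_self[OF H(1)]
    by (intro finite_measure_mono) (auto simp: borel_prob_def)
qed

text \<open>
  A group may have uncountably many right cosets, all of measure zero; tightness excludes this,
  since finitely many cosets already cover a compact set of measure at least \<open>1 / 2\<close>.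
\<close>

lemma tight_measure_pos_right_coset:
  fixes M :: "'a::{topological_group_add, t2_space} measure"
  assumes H: "add_subgroup H" "open H" and M: "borel_prob M" "tight_measure M"
  obtains x where "measure M (right_coset H x) > 0"
proof (rule ccontr)
  assume "\<not> thesis"
  then have null: "measure M (right_coset H x) = 0" for x
    using that by (metis measure_nonneg order_le_less)
  interpret prob_space M
    using M by (simp add: borel_prob_def)
  obtain K where K: "compact K" "measure M K \<ge> 1 - 1 / 2"
    using M(2) unfolding tight_measure_def by (metis half_gt_zero zero_less_one)
  have "right_coset H ` K \<subseteq> sets M"
    using open_right_coset[OF H(2)] M(1) by (auto simp: borel_prob_def)
  then have "measure M (\<Union>(right_coset H ` K)) \<le> (\<Sum>C\<in>right_coset H ` K. measure M C)"
    using finite_measure_subadditive_finite[of "right_coset H ` K" "\<lambda>C. C"]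
      finite_right_cosets_compact[OF H K(1)] by simp
  also have "\<dots> = 0"
    using null by (intro sum.neutral) auto
  finally show False
    using measure_compact_le_right_cosets[OF H M(1) K(1)] K(2) by simp
qed

lemma tendsto_0_ennrealI:
  fixes f :: "'i \<Rightarrow> ennreal"
  assumes "\<And>\<delta>. \<delta> > 0 \<Longrightarrow> eventually (\<lambda>i. f i \<le> ennreal \<delta>) F"
  shows "(f \<longlongrightarrow> 0) F"
proof (rule order_tendstoI)
  fix a :: ennreal assume "0 < a"
  then obtain d where d: "0 < d" "d < a"
    using dense by blast
  then obtain \<delta> where \<delta>: "d = ennreal \<delta>" "\<delta> > 0"
    by (cases d) auto
  show "eventually (\<lambda>i. f i < a) F"
    using assms[OF \<delta>(2)] by eventually_elim (use d \<delta> in auto)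
qed auto

theorem theorem5p1:
  fixes \<mu> :: "'i \<Rightarrow> 'a::{topological_group_add, t2_space} measure"
    and I :: "'i set" and r :: "('i \<times> 'i) set"
  assumes "\<exists>H :: 'a set. add_subgroup H \<and> open H \<and> infinite_index H"
    and "directed_on I r"
    and "\<And>i. i \<in> I \<Longrightarrow> borel_prob (\<mu> i)"
    and "\<And>i. i \<in> I \<Longrightarrow> tight_measure (\<mu> i)"
    and "UEB_converges_to_invariance I r \<mu>"
  shows "dissipates right_uniformity I r \<mu>"
proof -
  obtain H :: "'a set" where H: "add_subgroup H" "open H" "infinite_index H"
    using assms(1) by blast
  have small: "eventually (\<lambda>i. \<forall>x. measure (\<mu> i) (right_coset H x) \<le> \<delta>) (tails I r)"
    if "\<delta> > 0" for \<delta>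
    using eventually_uniformly_small_right_cosets[OF H assms(2) _ assms(5) that] assms(3) by blast
  have I: "eventually (\<lambda>i. i \<in> I) (tails I r)"
    using assms(2) by (auto simp: eventually_tails directed_on_def)
  \<comment> \<open>The error allowed at \<open>i\<close> is the measure of some coset: positive, yet tending to \<open>0\<close>.\<close>
  have "\<exists>K x. compact K \<and> measure (\<mu> i) K \<ge> 1 - measure (\<mu> i) (right_coset H x)"
    if "i \<in> I" for i
    using tight_measure_pos_right_coset[OF H(1,2) assms(3,4)[OF that]] assms(4)[OF that]
    unfolding tight_measure_def by metis
  then obtain K x where K: "\<And>i. i \<in> I \<Longrightarrow> compact (K i)"
    and mK: "\<And>i. i \<in> I \<Longrightarrow> measure (\<mu> i) (K i) \<ge> 1 - measure (\<mu> i) (right_coset H (x i))"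
    by metis
  define \<B> where "\<B> i = right_coset H ` K i" for i
  have emeas: "emeasure (\<mu> i) B = ennreal (measure (\<mu> i) B)" if "i \<in> I" for i B
  proof -
    interpret prob_space "\<mu> i"
      using assms(3)[OF that] by (simp add: borel_prob_def)
    show ?thesis
      by (rule emeasure_eq_measure)
  qed
  have "((\<lambda>i. measure (\<mu> i) (\<Union>(\<B> i))) \<longlongrightarrow> 1) (tails I r)"
  proof (rule order_tendstoI)
    fix a :: real assume "a < 1"
    then have "(1 - a) / 2 > 0"
      by simp
    from small[OF this] I show "eventually (\<lambda>i. a < measure (\<mu> i) (\<Union>(\<B> i))) (tails I r)"
    proof eventually_elim
      case (elim i)
      have "1 - (1 - a) / 2 \<le> 1 - measure (\<mu> i) (right_coset H (x i))"
        using elim(1) by auto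
      also have "\<dots> \<le> measure (\<mu> i) (K i)"
        by (rule mK[OF elim(2)])
      also have "\<dots> \<le> measure (\<mu> i) (\<Union>(\<B> i))"
        unfolding \<B>_def
        by (rule measure_compact_le_right_cosets[OF H(1,2) assms(3)[OF elim(2)] K[OF elim(2)]])
      finally show ?case
        using \<open>a < 1\<close> by (simp add: field_simps)
    qed
  next
    fix a :: real assume "1 < a"
    from I show "eventually (\<lambda>i. measure (\<mu> i) (\<Union>(\<B> i)) < a) (tails I r)"
    proof eventually_elim
      case (elim i)
      interpret prob_space "\<mu> i"
        using assms(3)[OF elim] by (simp add: borel_prob_def)
      show ?case
        using prob_le_1 \<open>1 < a\<close> by (rule le_less_trans)
    qed
  qed
  then have "((\<lambda>i. ennreal (measure (\<mu> i) (\<Union>(\<B> i)))) \<longlongrightarrow> ennreal 1) (tails I r)"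
    by (rule tendsto_ennrealI)
  moreover have "eventually (\<lambda>i. ennreal (measure (\<mu> i) (\<Union>(\<B> i))) = emeasure (\<mu> i) (\<Union>(\<B> i)))
      (tails I r)"
    using I by eventually_elim (simp add: emeas)
  ultimately have mass: "((\<lambda>i. emeasure (\<mu> i) (\<Union>(\<B> i))) \<longlongrightarrow> 1) (tails I r)"
    using Lim_transform_eventually by fastforce
  have atoms: "((\<lambda>i. SUP B\<in>\<B> i. emeasure (\<mu> i) B) \<longlongrightarrow> 0) (tails I r)"
  proof (rule tendsto_0_ennrealI)
    fix \<delta> :: real assume "\<delta> > 0"
    from small[OF this] I
    show "eventually (\<lambda>i. (SUP B\<in>\<B> i. emeasure (\<mu> i) B) \<le> ennreal \<delta>) (tails I r)"
      by eventually_elim (auto simp: \<B>_def emeas intro!: SUP_least ennreal_leI)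
  qed
  have "dissipates_wrt {(x, y). y - x \<in> H} I r \<mu>"
    unfolding dissipates_wrt_def
  proof (intro exI[of _ \<B>] conjI ballI impI mass atoms)
    fix i assume "i \<in> I"
    then show "finite (\<B> i)"
      unfolding \<B>_def by (intro finite_right_cosets_compact H K)
    show "\<B> i \<subseteq> sets borel"
      using open_right_coset[OF H(2)] by (auto simp: \<B>_def)
    show "(B \<times> C) \<inter> {(x, y). y - x \<in> H} = {}" if "B \<in> \<B> i" "C \<in> \<B> i" "B \<noteq> C" for B C
      using that right_cosets_separated[OF H(1)] by (auto simp: \<B>_def)
  qed
  then show ?thesis
    unfolding dissipates_def using entourage_open_subgroup[OF H(1,2)] by blast
qed

end
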